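(* Let $I \subset \mathbb{R}$ be a real interval, let $\le$ be the restriction of the usual order of $\mathbb{R}$ to $I$, and let $\circ : I^2 \to I$ be a binary operation such that $(I, \le, \circ)$ is a strictly linearly ordered semigroup. Suppose that every element of $I$ admits a square root. Then the operation $\circ : I^2 \to I$ is jointly continuous (i.e. continuous as a map from $I \times I$ with the product topology to $I$, where $I$ carries the usual topology).
   Context: A strictly linearly ordered semigroup is a tuple $(X, \le, \circ)$, where $X$ is a non-empty set, $\le$ is a linear order on $X$, and $\circ : X^2 \to X$ is an associative map such that $a < b$ implies $a \circ x < b \circ x$ and $x \circ a < x \circ b$ for all $a, b, x \in X$ (where $a<b$ means $a \le b$ and $a \ne b$). Here a real interval is any non-empty interval of $\mathbb{R}$ (open, closed, half-open, bounded or unbounded, possibly a single point). An element $x$ of a strictly linearly ordered semigroup admits a square root if there is an element $y$ of the semigroup such that $y \circ y = x$. *)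

theory Defs
  imports "HOL-Analysis.Analysis"
begin

text \<open>The operation is a total function on the ambient type; only its values on
  \<open>X \<times> X\<close> are constrained or used. The order is a relation on \<open>X\<close> in the sense of
  \<^const>\<open>linear_order_on\<close>.\<close>

locale strictly_linearly_ordered_semigroup =
  fixes X :: "'a set"
    and r :: "'a rel"
    and f :: "'a \<Rightarrow> 'a \<Rightarrow> 'a"
  assumes nonempty: "X \<noteq> {}"
    and linear_order: "linear_order_on X r"
    and closed: "\<lbrakk>a \<in> X; b \<in> X\<rbrakk> \<Longrightarrow> f a b \<in> X"
    and assoc: "\<lbrakk>a \<in> X; b \<in> X; c \<in> X\<rbrakk> \<Longrightarrow> f (f a b) c = f a (f b c)"
    and strict_mono_left:
      "\<lbrakk>a \<in> X; b \<in> X; x \<in> X; (a, b) \<in> r; a \<noteq> b\<rbrakk> \<Longrightarrow> (f a x, f b x) \<in> r \<and> f a x \<noteq> f b x"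
    and strict_mono_right:
      "\<lbrakk>a \<in> X; b \<in> X; x \<in> X; (a, b) \<in> r; a \<noteq> b\<rbrakk> \<Longrightarrow> (f x a, f x b) \<in> r \<and> f x a \<noteq> f x b"

definition admits_square_root :: "'a set \<Rightarrow> ('a \<Rightarrow> 'a \<Rightarrow> 'a) \<Rightarrow> 'a \<Rightarrow> bool" where
  "admits_square_root X f x \<longleftrightarrow> (\<exists>y\<in>X. f y y = x)"

definition usual_order_on :: "real set \<Rightarrow> real rel" where
  "usual_order_on I = {(x, y). x \<in> I \<and> y \<in> I \<and> x \<le> y}"

end

theory Submission
  imports Defs
begin

text \<open>If all elements are nonnegative (\<open>x \<le> x \<circ> x\<close>) and \<open>p\<close> is positive, the iterated square roots of
  \<open>p\<close> give powers \<open>p\<^sup>q\<close> for positive dyadic \<open>q\<close>, and \<open>\<phi> y = sup {q. p\<^sup>q \<le> y}\<close> is a monotone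
  homomorphism into the additive reals whose image contains all positive reals. It is injective: if \<open>u < w\<close> and
  \<open>\<phi> u = \<phi> w\<close>, then translating the interval \<open>(u, w)\<close> yields uncountably many disjoint
  nondegenerate intervals, one in each fibre of \<open>\<phi>\<close> over \<open>\<beta> + \<phi> u\<close>, \<open>\<beta> > 0\<close>. Hence \<open>\<phi>\<close> is a homeomorphism
  carrying the operation to addition. Nonpositive semigroups are reflected. In the remaining case there
  is an identity \<open>e\<close> and some element above \<open>e\<close> is invertible; then, near any given point,
  \<open>a \<circ> b = v \<circ> ((u \<circ> a) \<circ> (b \<circ> u)) \<circ> v\<close> for an invertible \<open>u\<close> so large that \<open>u \<circ> a\<close> and \<open>b \<circ> u\<close> are
  positive, with \<open>v\<close> its inverse.\<close>

section \<open>Continuity of monotone real functions\<close>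

text \<open>A monotone function can fail to be continuous only by jumping, and a jump leaves a gap
  in the image. Squaring, the additive coordinate with its inverse, and translations by invertible
  elements all get their continuity from this criterion.\<close>

lemma mono_on_interval_image_continuous_on:
  fixes g :: "real \<Rightarrow> real"
  assumes mono: "mono_on A g" and int: "is_interval (g ` A)"
  shows "continuous_on A g"
proof -
  have right: "\<exists>d>0. \<forall>y\<in>A. x \<le> y \<and> y < x + d \<longrightarrow> g y < g x + r" if x: "x \<in> A" and r: "0 < r" for x r
  proof (cases "\<exists>y\<in>A. x < y \<and> g y < g x + r")
    case True
    then obtain y0 where "y0 \<in> A" "x < y0" "g y0 < g x + r" by blast
    moreover have "g y \<le> g y0" if "y \<in> A" "y < y0" for y
      using mono that \<open>y0 \<in> A\<close> by (auto simp: mono_on_def)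
    ultimately show ?thesis
      by (intro exI[of _ "y0 - x"]) force
  next
    case False
    \<comment> \<open>Such a \<open>y\<close> would force the value \<open>g x + r/2\<close> to be
      attained, at a point above \<open>x\<close>, which this case excludes.\<close>
    have "\<not> x < y" if y: "y \<in> A" for y
    proof
      assume "x < y"
      with False y have "g x + r \<le> g y" by force
      moreover have "g x \<in> g ` A" "g y \<in> g ` A" using x y by auto
      ultimately have "g x + r/2 \<in> g ` A"
        using int r unfolding is_interval_1 by (smt (verit) field_sum_of_halves)
      then obtain z where z: "z \<in> A" "g z = g x + r/2" by auto
      then have "x < z"
        using mono x r unfolding mono_on_def by (smt (verit) half_gt_zero)
      with False z r show False by force
    qed
    then show ?thesis using r by (intro exI[of _ 1]) force
  qed
  have left: "\<exists>d>0. \<forall>y\<in>A. y \<le> x \<and> x - d < y \<longrightarrow> g x - r < g y" if x: "x \<in> A" and r: "0 < r" for x r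
  proof (cases "\<exists>y\<in>A. y < x \<and> g x - r < g y")
    case True
    then obtain y0 where "y0 \<in> A" "y0 < x" "g x - r < g y0" by blast
    moreover have "g y0 \<le> g y" if "y \<in> A" "y0 < y" for y
      using mono that \<open>y0 \<in> A\<close> by (auto simp: mono_on_def)
    ultimately show ?thesis
      by (intro exI[of _ "x - y0"]) force
  next
    case False
    have "\<not> y < x" if y: "y \<in> A" for y
    proof
      assume "y < x"
      with False y have "g y \<le> g x - r" by force
      moreover have "g x \<in> g ` A" "g y \<in> g ` A" using x y by auto
      ultimately have "g x - r/2 \<in> g ` A"
        using int r unfolding is_interval_1 by (smt (verit) field_sum_of_halves)
      then obtain z where z: "z \<in> A" "g z = g x - r/2" by auto
      then have "z < x"
        using mono x r unfolding mono_on_def by (smt (verit) half_gt_zero)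
      with False z r show False by force
    qed
    then show ?thesis using r by (intro exI[of _ 1]) force
  qed
  show ?thesis
    unfolding continuous_on_iff
  proof (intro ballI allI impI)
    fix x and r :: real
    assume x: "x \<in> A" and r: "0 < r"
    from right[OF this] obtain d1
      where d1: "d1 > 0" "\<And>y. \<lbrakk>y \<in> A; x \<le> y; y < x + d1\<rbrakk> \<Longrightarrow> g y < g x + r" by blast
    from left[OF x r] obtain d2
      where d2: "d2 > 0" "\<And>y. \<lbrakk>y \<in> A; y \<le> x; x - d2 < y\<rbrakk> \<Longrightarrow> g x - r < g y" by blast
    have "dist (g y) (g x) < r" if y: "y \<in> A" "dist y x < min d1 d2" for y
    proof (cases "x \<le> y")
      case True
      moreover from this have "g x \<le> g y" using mono x y by (auto simp: mono_on_def)
      ultimately show ?thesis using d1(2)[OF y(1)] y(2) by (auto simp: dist_real_def)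
    next
      case False
      moreover from this have "g y \<le> g x" using mono x y by (auto simp: mono_on_def)
      ultimately show ?thesis using d2(2)[OF y(1)] y(2) by (auto simp: dist_real_def)
    qed
    then show "\<exists>d>0. \<forall>x'\<in>A. dist x' x < d \<longrightarrow> dist (g x') (g x) < r"
      using d1(1) d2(1) by (intro exI[of _ "min d1 d2"]) auto
  qed
qed

section \<open>Order, squares and powers in interval semigroups with roots\<close>

primrec semigroup_power :: "('a \<Rightarrow> 'a \<Rightarrow> 'a) \<Rightarrow> 'a \<Rightarrow> nat \<Rightarrow> 'a" where
  \<comment> \<open>the exponent is shifted: \<open>semigroup_power f a n\<close> is \<open>a\<^bsup>n+1\<^esup>\<close>\<close>
  "semigroup_power f a 0 = a"
| "semigroup_power f a (Suc n) = f (semigroup_power f a n) a"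

text \<open>A locale, because the results are also applied to the reflected semigroup and to the
  part above an identity.\<close>

locale rooted_interval_semigroup =
  fixes I :: "real set" and f :: "real \<Rightarrow> real \<Rightarrow> real"
  assumes interval: "is_interval I"
    and closed: "\<lbrakk>a \<in> I; b \<in> I\<rbrakk> \<Longrightarrow> f a b \<in> I"
    and assoc: "\<lbrakk>a \<in> I; b \<in> I; c \<in> I\<rbrakk> \<Longrightarrow> f (f a b) c = f a (f b c)"
    and less_left: "\<lbrakk>a \<in> I; b \<in> I; x \<in> I; a < b\<rbrakk> \<Longrightarrow> f a x < f b x"
    and less_right: "\<lbrakk>a \<in> I; b \<in> I; x \<in> I; a < b\<rbrakk> \<Longrightarrow> f x a < f x b"
    and root: "x \<in> I \<Longrightarrow> \<exists>y\<in>I. f y y = x"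
begin

lemma between: "\<lbrakk>a \<in> I; b \<in> I; a \<le> x; x \<le> b\<rbrakk> \<Longrightarrow> x \<in> I"
  using interval unfolding is_interval_1 by blast

lemma le_left: "\<lbrakk>a \<in> I; b \<in> I; x \<in> I; a \<le> b\<rbrakk> \<Longrightarrow> f a x \<le> f b x"
  using less_left[of a b x] by fastforce

lemma le_right: "\<lbrakk>a \<in> I; b \<in> I; x \<in> I; a \<le> b\<rbrakk> \<Longrightarrow> f x a \<le> f x b"
  using less_right[of a b x] by fastforce

lemma less_left_iff: "\<lbrakk>a \<in> I; b \<in> I; x \<in> I\<rbrakk> \<Longrightarrow> f a x < f b x \<longleftrightarrow> a < b"
  using less_left[of a b x] le_left[of b a x] by fastforce

lemma less_right_iff: "\<lbrakk>a \<in> I; b \<in> I; x \<in> I\<rbrakk> \<Longrightarrow> f x a < f x b \<longleftrightarrow> a < b"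
  using less_right[of a b x] le_right[of b a x] by fastforce

lemma eq_left_iff: "\<lbrakk>a \<in> I; b \<in> I; x \<in> I\<rbrakk> \<Longrightarrow> f a x = f b x \<longleftrightarrow> a = b"
  using less_left[of a b x] less_left[of b a x] by fastforce

lemma eq_right_iff: "\<lbrakk>a \<in> I; b \<in> I; x \<in> I\<rbrakk> \<Longrightarrow> f x a = f x b \<longleftrightarrow> a = b"
  using less_right[of a b x] less_right[of b a x] by fastforce

lemma square_less: "\<lbrakk>a \<in> I; b \<in> I; a < b\<rbrakk> \<Longrightarrow> f a a < f b b"
  using less_left[of a b a] less_right[of a b b] by linarith

lemma square_less_iff: "\<lbrakk>a \<in> I; b \<in> I\<rbrakk> \<Longrightarrow> f a a < f b b \<longleftrightarrow> a < b"
  using square_less[of a b] square_less[of b a] by (cases a b rule: linorder_cases) auto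

text \<open>Squaring is strictly increasing, and the existence of roots makes it map
  \<open>I\<close> onto \<open>I\<close>.\<close>

lemma continuous_on_square: "continuous_on I (\<lambda>x. f x x)"
proof (rule mono_on_interval_image_continuous_on)
  show "mono_on I (\<lambda>x. f x x)"
    using square_less by (intro mono_onI) (metis order.order_iff_strict)
  have "(\<lambda>x. f x x) ` I = I" using root closed by force
  then show "is_interval ((\<lambda>x. f x x) ` I)" using interval by simp
qed

text \<open>Multiplying x < x x by y gives x y < x (x y), from which the left factor x
  cancels.\<close>

lemma less_mult_left:
  assumes "x \<in> I" "y \<in> I" "x < f x x" shows "y < f x y"
proof -
  have "f x y < f x (f x y)" using assms less_left[of x "f x x" y] closed assoc by simp
  then show ?thesis using assms less_right_iff closed by blast
qed

lemma less_mult_right: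
  assumes "x \<in> I" "y \<in> I" "x < f x x" shows "y < f y x"
proof -
  have "f y x < f (f y x) x" using assms less_right[of x "f x x" y] closed assoc by simp
  then show ?thesis using assms less_left_iff closed by blast
qed

text \<open>Cancel \<open>e\<close> from e (e y) = e y, and symmetrically on the right.\<close>

lemma idempotent_neutral:
  assumes "e \<in> I" "f e e = e" "y \<in> I" shows "f e y = y" "f y e = y"
proof -
  have "f e (f e y) = f e y" using assms assoc[of e e y] by simp
  then show "f e y = y" using assms eq_right_iff closed by blast
  have "f (f y e) e = f y e" using assms assoc[of y e e] by simp
  then show "f y e = y" using assms eq_left_iff closed by blast
qed

lemma nonneg_le_mult_left:
  assumes "x \<in> I" "y \<in> I" "x \<le> f x x" shows "y \<le> f x y"
  using assms less_mult_left[of x y] idempotent_neutral[of x y] by fastforce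

lemma square_iterate_in: "x \<in> I \<Longrightarrow> ((\<lambda>x. f x x) ^^ n) x \<in> I"
  by (induction n) (auto intro: closed)

text \<open>An Archimedean property. Bounded iterates would increase to some \<open>L\<close> in
  \<open>I\<close>, idempotent by continuity of squaring and hence an identity. Then x L = x,
  whereas positivity of \<open>x\<close> gives L < x L, contradicting x \<le> L.\<close>

lemma square_iterate_unbounded:
  assumes x: "x \<in> I" "x < f x x" and y: "y \<in> I"
  shows "\<exists>n. y < ((\<lambda>x. f x x) ^^ n) x"
proof (rule ccontr)
  assume bounded: "\<nexists>n. y < ((\<lambda>x. f x x) ^^ n) x"
  define X where "X n = ((\<lambda>x. f x x) ^^ n) x" for n
  have le: "X n \<le> y" for n using bounded unfolding X_def by (simp add: not_less)
  have XI: "X n \<in> I" for n unfolding X_def by (rule square_iterate_in[OF x(1)])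
  have XS: "X (Suc n) = f (X n) (X n)" for n by (simp add: X_def)
  have "X n < X (Suc n)" for n
  proof (induction n)
    case 0 then show ?case using x by (simp add: X_def)
  next
    case (Suc n) then show ?case using square_less[OF XI XI] by (metis XS)
  qed
  then have inc: "incseq X" by (intro incseq_SucI less_imp_le)
  then obtain L where L: "X \<longlonglongrightarrow> L" "\<And>n. X n \<le> L"
    using incseq_convergent[of X y] le by blast
  have "L \<le> y" using L(1) le by (intro LIMSEQ_le_const2) auto
  moreover have xL: "x \<le> L" using L(2)[of 0] by (simp add: X_def)
  ultimately have LI: "L \<in> I" using between x y by blast
  have "(\<lambda>n. f (X n) (X n)) \<longlonglongrightarrow> f L L"
    using continuous_on_tendsto_compose[OF continuous_on_square L(1) LI] XI by simp
  moreover have "(\<lambda>n. f (X n) (X n)) \<longlonglongrightarrow> L"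
    using LIMSEQ_Suc[OF L(1)] by (simp add: XS)
  ultimately have "f L L = L" using LIMSEQ_unique by blast
  then have "f x L = x" using idempotent_neutral LI x by blast
  moreover have "L < f x L" using less_mult_left LI x by blast
  ultimately show False using xL by simp
qed

text \<open>Negation exchanges positive and negative elements, so each result for one sign yields
  its mirror image.\<close>

lemma reflect: "rooted_interval_semigroup (uminus ` I) (\<lambda>x y. - f (- x) (- y))"
proof
  show "is_interval (uminus ` I)"
    using interval is_interval_neg_translationI[of I 0] by simp
  show "\<exists>y\<in>uminus ` I. - f (- y) (- y) = x" if "x \<in> uminus ` I" for x
    using root that by force
qed (auto simp: closed assoc less_left less_right)

lemma restrict:
  assumes "is_interval J" "J \<subseteq> I"
    and "\<And>a b. \<lbrakk>a \<in> J; b \<in> J\<rbrakk> \<Longrightarrow> f a b \<in> J"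
    and "\<And>y. \<lbrakk>y \<in> I; f y y \<in> J\<rbrakk> \<Longrightarrow> y \<in> J"
  shows "rooted_interval_semigroup J f"
proof
  show "\<exists>y\<in>J. f y y = x" if "x \<in> J" for x
    using root[of x] assms that by blast
  show "f (f a b) c = f a (f b c)" if "a \<in> J" "b \<in> J" "c \<in> J" for a b c
    using that assms(2) by (intro assoc) auto
  show "f a x < f b x" "f x a < f x b" if "a \<in> J" "b \<in> J" "x \<in> J" "a < b" for a b x
    using that assms(2) less_left[of a b x] less_right[of a b x] by auto
qed (use assms in auto)

lemma semigroup_power_in: "a \<in> I \<Longrightarrow> semigroup_power f a n \<in> I"
  by (induction n) (auto intro: closed)

text \<open>The true exponents m+1 and n+1 add up to m+n+2, whose shifted index is
  \<open>Suc (m + n)\<close>.\<close>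

lemma semigroup_power_add:
  "a \<in> I \<Longrightarrow> f (semigroup_power f a m) (semigroup_power f a n) = semigroup_power f a (Suc (m + n))"
  by (induction n) (auto simp: semigroup_power_in closed assoc[symmetric])

lemma semigroup_power_square:
  assumes "a \<in> I" shows "semigroup_power f (f a a) n = semigroup_power f a (Suc (2 * n))"
proof (induction n)
  case (Suc n)
  then show ?case using assms semigroup_power_in[OF assms, of "Suc (2 * n)"] closed assoc by simp
qed auto

lemma semigroup_power_strict_mono:
  assumes "a \<in> I" "a < f a a" "m < n"
  shows "semigroup_power f a m < semigroup_power f a n"
proof -
  have "strict_mono (semigroup_power f a)"
    using assms less_mult_right[of a] semigroup_power_in by (auto simp: strict_mono_Suc_iff)
  then show ?thesis using assms by (simp add: strict_mono_def)
qed

end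

section \<open>Positive dyadic rationals\<close>

definition pos_dyadics :: "real set" where
  "pos_dyadics = {real (Suc k) / 2 ^ n | k n. True}"

lemma pos_dyadics_pos: "q \<in> pos_dyadics \<Longrightarrow> 0 < q"
  by (auto simp: pos_dyadics_def)

lemma pos_dyadics_common_denominator:
  assumes "q \<in> pos_dyadics" "r \<in> pos_dyadics"
  obtains k l n where "q = real (Suc k) / 2 ^ n" "r = real (Suc l) / 2 ^ n"
proof -
  obtain k m l n where q: "q = real (Suc k) / 2 ^ m" and r: "r = real (Suc l) / 2 ^ n"
    using assms by (auto simp: pos_dyadics_def)
  \<comment> \<open>Numerators have the form \<open>Suc k\<close>, so a product of positive numbers
    must be written as the successor of its predecessor.\<close>
  have "real (Suc (Suc i * 2 ^ j - 1)) = real (Suc i) * 2 ^ j" for i j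
    by (simp del: of_nat_Suc mult_Suc)
  then have "q = real (Suc (Suc k * 2 ^ n - 1)) / 2 ^ (m + n)"
       "r = real (Suc (Suc l * 2 ^ m - 1)) / 2 ^ (m + n)"
    unfolding q r by (simp_all add: power_add del: of_nat_Suc)
  then show ?thesis using that by blast
qed

lemma pos_dyadics_add:
  assumes "q \<in> pos_dyadics" "r \<in> pos_dyadics" shows "q + r \<in> pos_dyadics"
proof -
  obtain k l n where "q = real (Suc k) / 2 ^ n" "r = real (Suc l) / 2 ^ n"
    using pos_dyadics_common_denominator[OF assms] .
  then have "q + r = real (Suc (Suc (k + l))) / 2 ^ n" by (simp add: field_simps)
  then show ?thesis unfolding pos_dyadics_def by blast
qed

lemma pos_dyadics_dense:
  assumes "0 \<le> a" "a < (b :: real)"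
  obtains q where "q \<in> pos_dyadics" "a < q" "q < b"
proof -
  obtain n where n: "1 / 2 ^ n < b - a"
    using real_arch_pow_inv[of "b - a" "1/2"] assms by (auto simp: power_one_over)
  \<comment> \<open>\<open>Suc k / 2 ^ n\<close> is the first multiple of 1/2^n strictly beyond
    \<open>a\<close>.\<close>
  define k where "k = nat \<lfloor>a * 2 ^ n\<rfloor>"
  have "real k \<le> a * 2 ^ n" "a * 2 ^ n < real k + 1"
    using assms unfolding k_def by (auto simp: of_nat_nat)
  then have "a < real (Suc k) / 2 ^ n" "real (Suc k) / 2 ^ n \<le> a + 1 / 2 ^ n"
    by (auto simp: field_simps)
  then show ?thesis
    using n that[of "real (Suc k) / 2 ^ n"] unfolding pos_dyadics_def by force
qed

section \<open>Dyadic powers and the additive coordinate\<close>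

context rooted_interval_semigroup
begin

text \<open>With \<open>r n\<close> the n-fold iterated root of \<open>p\<close>, the exponent
  (k+1)/2^n is realised by the (k+1)-th power of \<open>r n\<close>. Over a common denominator,
  addition and order of exponents become those of powers of one positive element.\<close>

lemma dyadic_power_exists:
  assumes p: "p \<in> I" "p < f p p"
  obtains E where "\<And>q. q \<in> pos_dyadics \<Longrightarrow> E q \<in> I"
    "\<And>q r. \<lbrakk>q \<in> pos_dyadics; r \<in> pos_dyadics\<rbrakk> \<Longrightarrow> E (q + r) = f (E q) (E r)"
    "\<And>q r. \<lbrakk>q \<in> pos_dyadics; r \<in> pos_dyadics; q < r\<rbrakk> \<Longrightarrow> E q < E r"
    "\<And>y. y \<in> I \<Longrightarrow> \<exists>q\<in>pos_dyadics. y < E q"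
proof -
  define rt where "rt x = (SOME y. y \<in> I \<and> f y y = x)" for x
  have rt: "rt x \<in> I \<and> f (rt x) (rt x) = x" if "x \<in> I" for x
    unfolding rt_def using root[OF that] someI_ex[of "\<lambda>y. y \<in> I \<and> f y y = x"] by blast
  define r where "r n = (rt ^^ n) p" for n
  have r0: "r 0 = p" and rS: "r (Suc n) = rt (r n)" for n by (auto simp: r_def)
  have rI: "r n \<in> I" for n by (induction n) (auto simp: r0 rS p rt)
  have sq: "f (r (Suc n)) (r (Suc n)) = r n" for n using rt[OF rI] by (simp add: rS)
  have pos: "r n < f (r n) (r n)" for n
  proof (induction n)
    case (Suc n)
    then have "f (r (Suc n)) (r (Suc n)) < f (f (r (Suc n)) (r (Suc n))) (f (r (Suc n)) (r (Suc n)))"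
      by (simp add: sq)
    then show ?case using square_less_iff rI closed by blast
  qed (simp add: r0 p)
  \<comment> \<open>In true exponents: the (k+1)-th power of \<open>r n\<close> is the (k+1) 2^m-th
    power of \<open>r (n + m)\<close>. This makes \<open>E\<close> below independent of the fraction
    representing \<open>q\<close>.\<close>
  have refine: "semigroup_power f (r n) k = semigroup_power f (r (n + m)) (Suc k * 2 ^ m - 1)" for n k m
  proof (induction m)
    case (Suc m)
    have split: "semigroup_power f (r (n + m)) (Suc k * 2 ^ m - 1)
        = semigroup_power f (r (Suc (n + m))) (Suc (2 * (Suc k * 2 ^ m - 1)))"
      using semigroup_power_square[OF rI, of "Suc (n + m)" "Suc k * 2 ^ m - 1"] by (simp only: sq)
    have exponent: "Suc (2 * (Suc k * 2 ^ m - 1)) = Suc k * 2 ^ Suc m - 1"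
    proof -
      have "Suc k * 2 ^ m \<ge> 1" by (simp del: mult_Suc)
      moreover have "Suc k * 2 ^ Suc m = 2 * (Suc k * 2 ^ m)" by (simp del: mult_Suc)
      ultimately show ?thesis by linarith
    qed
    show ?case by (simp only: Suc.IH split exponent add_Suc_right)
  qed simp
  define E where "E q = (SOME v. \<exists>k n. q = real (Suc k) / 2 ^ n \<and> v = semigroup_power f (r n) k)" for q
  have E: "E (real (Suc k) / 2 ^ n) = semigroup_power f (r n) k" for k n
  proof -
    have "v = semigroup_power f (r n) k"
      if "real (Suc k) / 2 ^ n = real (Suc l) / 2 ^ m" "v = semigroup_power f (r m) l" for v l m
    proof -
      have "real (Suc k) * 2 ^ m = real (Suc l) * 2 ^ n"
        using that(1) by (simp add: frac_eq_eq del: of_nat_Suc)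
      then have "real (Suc k * 2 ^ m) = real (Suc l * 2 ^ n)"
        by (simp del: of_nat_Suc mult_Suc)
      then have "Suc k * 2 ^ m = Suc l * 2 ^ n" by (simp only: of_nat_eq_iff)
      then show ?thesis
        using refine[of n k m] refine[of m l n] that(2) by (simp add: add.commute)
    qed
    then show ?thesis unfolding E_def by (intro some_equality) blast+
  qed
  show ?thesis
  proof (rule that[of E])
    show "E q \<in> I" if q: "q \<in> pos_dyadics" for q
    proof -
      obtain k n where "q = real (Suc k) / 2 ^ n"
        using q unfolding pos_dyadics_def by blast
      then show ?thesis by (simp only: E semigroup_power_in[OF rI])
    qed
    show "E (q + q') = f (E q) (E q')" if q: "q \<in> pos_dyadics" "q' \<in> pos_dyadics" for q q'
    proof -
      obtain k l n where eq: "q = real (Suc k) / 2 ^ n" "q' = real (Suc l) / 2 ^ n"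
        using pos_dyadics_common_denominator[OF q] .
      then have "q + q' = real (Suc (Suc (k + l))) / 2 ^ n" by (simp add: field_simps)
      then show ?thesis by (simp only: E eq semigroup_power_add[OF rI])
    qed
    show "E q < E q'" if q: "q \<in> pos_dyadics" "q' \<in> pos_dyadics" "q < q'" for q q'
    proof -
      obtain k l n where eq: "q = real (Suc k) / 2 ^ n" "q' = real (Suc l) / 2 ^ n"
        using pos_dyadics_common_denominator[OF q(1,2)] .
      then have "k < l" using q(3) by (simp add: divide_less_cancel)
      then show ?thesis by (simp only: E eq semigroup_power_strict_mono[OF rI pos])
    qed
    show "\<exists>q\<in>pos_dyadics. y < E q" if y: "y \<in> I" for y
    proof -
      \<comment> \<open>An n-fold square is a 2^n-th power, so unboundedness of iterated squares
        passes to the powers.\<close>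
      have it: "((\<lambda>x. f x x) ^^ n) p = semigroup_power f p (2 ^ n - 1)" for n
      proof (induction n)
        case (Suc n)
        have exponent: "Suc (2 ^ n - 1 + (2 ^ n - 1)) = (2 ^ Suc n - 1 :: nat)"
        proof -
          have "(1::nat) \<le> 2 ^ n" by simp
          then show ?thesis unfolding power_Suc by linarith
        qed
        show ?case
          by (simp only: funpow.simps comp_def Suc.IH semigroup_power_add[OF p(1)] exponent)
      qed simp
      obtain n where "y < semigroup_power f p (2 ^ n - 1)"
        using square_iterate_unbounded[OF p y] it by auto
      moreover have "semigroup_power f p (2 ^ n - 1) = E (real (Suc (2 ^ n - 1)) / 2 ^ 0)"
        unfolding E r0 ..
      moreover have "real (Suc (2 ^ n - 1)) / 2 ^ 0 \<in> pos_dyadics"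
        unfolding pos_dyadics_def by blast
      ultimately show ?thesis by metis
    qed
  qed
qed

text \<open>The last two conclusions leave open only whether 0 is attained, which happens exactly
  when \<open>I\<close> contains an identity.\<close>

lemma additive_coordinate:
  assumes nonneg: "\<And>x. x \<in> I \<Longrightarrow> x \<le> f x x" and p: "p \<in> I" "p < f p p"
  obtains \<phi> where "strict_mono_on I (\<phi> :: real \<Rightarrow> real)"
    "\<And>x y. \<lbrakk>x \<in> I; y \<in> I\<rbrakk> \<Longrightarrow> \<phi> (f x y) = \<phi> x + \<phi> y"
    "\<phi> ` I \<subseteq> {0..}" "{0<..} \<subseteq> \<phi> ` I"
proof -
  obtain E where EI: "\<And>q. q \<in> pos_dyadics \<Longrightarrow> E q \<in> I"
    and E_add: "\<And>q r. \<lbrakk>q \<in> pos_dyadics; r \<in> pos_dyadics\<rbrakk> \<Longrightarrow> E (q + r) = f (E q) (E r)"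
    and E_less: "\<And>q r. \<lbrakk>q \<in> pos_dyadics; r \<in> pos_dyadics; q < r\<rbrakk> \<Longrightarrow> E q < E r"
    and E_unb: "\<And>y. y \<in> I \<Longrightarrow> \<exists>q\<in>pos_dyadics. y < E q"
    using dyadic_power_exists[OF p] by metis
  have E_le: "q \<le> r" if "q \<in> pos_dyadics" "r \<in> pos_dyadics" "E q \<le> E r" for q r
    using E_less[of r q] that by force
  \<comment> \<open>The inserted 0 keeps the set nonempty and gives coordinate 0 to elements below
    every dyadic power.\<close>
  define D where "D y = insert 0 {q \<in> pos_dyadics. E q \<le> y}" for y
  define \<phi> where "\<phi> y = Sup (D y)" for y
  have bdd: "bdd_above (D y)" if y: "y \<in> I" for y
  proof -
    obtain r where r: "r \<in> pos_dyadics" "y < E r" using E_unb[OF y] by blast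
    have "q \<le> r" if "q \<in> D y" for q
      using that r E_le[of q r] pos_dyadics_pos[of r] by (auto simp: D_def)
    then show ?thesis by (rule bdd_aboveI)
  qed
  have upper: "q \<le> \<phi> y" if "q \<in> pos_dyadics" "y \<in> I" "E q \<le> y" for q y
    unfolding \<phi>_def using that by (intro cSup_upper bdd) (auto simp: D_def)
  have phi_nonneg: "0 \<le> \<phi> y" if "y \<in> I" for y
    unfolding \<phi>_def using that by (intro cSup_upper bdd) (auto simp: D_def)
  have least: "\<phi> y \<le> r" if "0 \<le> r" "\<And>q. \<lbrakk>q \<in> pos_dyadics; E q \<le> y\<rbrakk> \<Longrightarrow> q \<le> r" for y r
    unfolding \<phi>_def using that by (intro cSup_least) (auto simp: D_def)
  have above: "y < E q" if "q \<in> pos_dyadics" "y \<in> I" "\<phi> y < q" for q y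
    using upper[of q y] that by force
  have below: "E q \<le> y" if q: "q \<in> pos_dyadics" "q < \<phi> y" for q y
  proof -
    obtain r where r: "r \<in> D y" "q < r"
      using q(2) less_cSupD[of "D y" q] unfolding \<phi>_def by (auto simp: D_def)
    then have "r \<in> pos_dyadics" "E r \<le> y"
      using pos_dyadics_pos[OF q(1)] by (auto simp: D_def)
    then show ?thesis using E_less[OF q(1) _ r(2)] by force
  qed
  have mono: "\<phi> x \<le> \<phi> y" if "x \<in> I" "y \<in> I" "x \<le> y" for x y
    using that upper by (intro least phi_nonneg) force+
  have le_mult_right: "x \<le> f x y" if "x \<in> I" "y \<in> I" for x y
    using that nonneg[of y] less_mult_right[of y x] idempotent_neutral[of y x] by fastforce
  have add_le: "\<phi> (f x y) \<le> \<phi> x + \<phi> y" if x: "x \<in> I" and y: "y \<in> I" for x y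
  proof (rule ccontr)
    assume contr: "\<not> \<phi> (f x y) \<le> \<phi> x + \<phi> y"
    \<comment> \<open>Half the supposed excess, so that exponents \<open>q\<close> and
      \<open>r\<close> within \<epsilon> above the two coordinates still satisfy q + r <
      \<open>\<phi> (f x y)\<close>.\<close>
    define \<epsilon> where "\<epsilon> = (\<phi> (f x y) - \<phi> x - \<phi> y) / 2"
    have \<epsilon>: "\<epsilon> > 0" "\<phi> (f x y) = \<phi> x + \<phi> y + 2 * \<epsilon>" using contr by (auto simp: \<epsilon>_def field_simps)
    obtain q where q: "q \<in> pos_dyadics" "\<phi> x < q" "q < \<phi> x + \<epsilon>"
      using pos_dyadics_dense[of "\<phi> x" "\<phi> x + \<epsilon>"] phi_nonneg[OF x] \<epsilon>(1) by auto
    obtain r where r: "r \<in> pos_dyadics" "\<phi> y < r" "r < \<phi> y + \<epsilon>"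
      using pos_dyadics_dense[of "\<phi> y" "\<phi> y + \<epsilon>"] phi_nonneg[OF y] \<epsilon>(1) by auto
    have "f x y < f (E q) y" "f (E q) y < f (E q) (E r)"
      using above[OF q(1) x q(2)] above[OF r(1) y r(2)] x y EI q r
      by (auto intro: less_left less_right)
    then have "f x y < E (q + r)" using E_add q r by simp
    moreover have "E (q + r) \<le> f x y"
      using below[of "q + r" "f x y"] pos_dyadics_add q r \<epsilon> by auto
    ultimately show False by simp
  qed
  have add_ge: "\<phi> x + \<phi> y \<le> \<phi> (f x y)" if x: "x \<in> I" and y: "y \<in> I" for x y
  \<comment> \<open>A coordinate 0 has no positive dyadic below it; there monotonicity with x \<le>
    x y and y \<le> x y is enough.\<close>
  proof (cases "\<phi> x = 0 \<or> \<phi> y = 0")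
    case True
    then show ?thesis
      using mono[of y "f x y"] mono[of x "f x y"] nonneg_le_mult_left[OF x y] le_mult_right[OF x y]
        nonneg[OF x] closed x y by auto
  next
    case False
    then have pos: "0 < \<phi> x" "0 < \<phi> y" using phi_nonneg x y by force+
    show ?thesis
    proof (rule ccontr)
      assume contr: "\<not> \<phi> x + \<phi> y \<le> \<phi> (f x y)"
      define \<epsilon> where "\<epsilon> = (\<phi> x + \<phi> y - \<phi> (f x y)) / 2"
      have \<epsilon>: "\<epsilon> > 0" "\<phi> (f x y) = \<phi> x + \<phi> y - 2 * \<epsilon>" using contr by (auto simp: \<epsilon>_def field_simps)
      obtain q where q: "q \<in> pos_dyadics" "max 0 (\<phi> x - \<epsilon>) < q" "q < \<phi> x"
        using pos_dyadics_dense[of "max 0 (\<phi> x - \<epsilon>)" "\<phi> x"] pos \<epsilon>(1) by auto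
      obtain r where r: "r \<in> pos_dyadics" "max 0 (\<phi> y - \<epsilon>) < r" "r < \<phi> y"
        using pos_dyadics_dense[of "max 0 (\<phi> y - \<epsilon>)" "\<phi> y"] pos \<epsilon>(1) by auto
      have "f (E q) (E r) \<le> f x (E r)" "f x (E r) \<le> f x y"
        using below[OF q(1,3)] below[OF r(1,3)] x y EI q r
        by (auto intro: le_left le_right)
      then have "q + r \<le> \<phi> (f x y)"
        using upper[of "q + r" "f x y"] E_add pos_dyadics_add closed q r x y by auto
      then show False using q r \<epsilon> by auto
    qed
  qed
  have hom: "\<phi> (f x y) = \<phi> x + \<phi> y" if "x \<in> I" "y \<in> I" for x y
    using add_le add_ge that by (intro antisym)
  have surj: "\<exists>y\<in>I. \<phi> y = \<beta>" if \<beta>: "0 < \<beta>" for \<beta>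
  proof -
    \<comment> \<open>This supremum lies between two dyadic powers \<open>E q0\<close> and
      \<open>E q1\<close>, hence in the interval \<open>I\<close>.\<close>
    define y where "y = Sup (E ` {q \<in> pos_dyadics. q < \<beta>})"
    obtain q0 where q0: "q0 \<in> pos_dyadics" "q0 < \<beta>" using pos_dyadics_dense[of 0 \<beta>] \<beta> by auto
    obtain q1 where q1: "q1 \<in> pos_dyadics" "\<beta> < q1"
      using pos_dyadics_dense[of \<beta> "\<beta> + 1"] \<beta> by auto
    have E_bound: "E q \<le> E r" if "q \<in> pos_dyadics" "q < \<beta>" "r \<in> pos_dyadics" "\<beta> < r" for q r
      using E_less[of q r] that by force
    have y_upper: "E q \<le> y" if "q \<in> pos_dyadics" "q < \<beta>" for q
      unfolding y_def using that E_bound[of _ q1] q1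
      by (intro cSup_upper) (auto intro!: bdd_aboveI[of _ "E q1"])
    have y_least: "y \<le> E r" if "r \<in> pos_dyadics" "\<beta> < r" for r
      unfolding y_def using that E_bound[of _ r] q0 by (intro cSup_least) auto
    have yI: "y \<in> I" using between y_upper[OF q0] y_least[OF q1] EI q0 q1 by blast
    have "\<not> \<phi> y < \<beta>"
    proof
      assume "\<phi> y < \<beta>"
      then obtain q where "q \<in> pos_dyadics" "\<phi> y < q" "q < \<beta>"
        using pos_dyadics_dense phi_nonneg[OF yI] by metis
      then show False using upper[OF _ yI] y_upper by force
    qed
    moreover have "\<not> \<beta> < \<phi> y"
    proof
      assume "\<beta> < \<phi> y"
      then obtain r where r: "r \<in> pos_dyadics" "\<beta> < r" "r < \<phi> y"
        using pos_dyadics_dense[of \<beta> "\<phi> y"] \<beta> by auto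
      \<comment> \<open>A second exponent gives strictness: y \<le> \<open>E q\<close> <
        \<open>E r\<close> \<le> y.\<close>
      then obtain q where "q \<in> pos_dyadics" "\<beta> < q" "q < r"
        using pos_dyadics_dense[of \<beta> r] \<beta> by auto
      then show False using r below[of r y] y_least[of q] E_less[of q r] by force
    qed
    ultimately show ?thesis using yI by (intro bexI[of _ y]) linarith+
  qed
  have strict: "\<phi> u < \<phi> w" if uw: "u \<in> I" "w \<in> I" "u < w" for u w
  proof (rule ccontr)
    assume "\<not> \<phi> u < \<phi> w"
    then have eq: "\<phi> w = \<phi> u" using mono[of u w] uw by simp
    \<comment> \<open>Translating by an element \<open>a\<close> of coordinate \<beta> puts the
      whole interval from \<open>f a u\<close> to \<open>f a w\<close> into one fibre, which
      therefore contains a rational. So countably many rationals would cover an uncountable ray of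
      values.\<close>
    have fibre: "\<exists>s\<in>\<rat>. \<phi> s = \<beta> + \<phi> u" if \<beta>: "0 < \<beta>" for \<beta>
    proof -
      obtain a where a: "a \<in> I" "\<phi> a = \<beta>" using surj[OF \<beta>] by blast
      obtain s where s: "s \<in> \<rat>" "f a u < s" "s < f a w"
        using Rats_dense_in_real less_right a uw by blast
      then have sI: "s \<in> I" using between closed a uw by (meson less_imp_le)
      have "\<phi> (f a u) \<le> \<phi> s" "\<phi> s \<le> \<phi> (f a w)"
        using s sI closed a uw by (auto intro!: mono)
      then have "\<phi> s = \<beta> + \<phi> u" using hom a uw eq by simp
      then show ?thesis using s by blast
    qed
    have "\<gamma> \<in> \<phi> ` \<rat>" if "\<phi> u < \<gamma>" for \<gamma>
      using fibre[of "\<gamma> - \<phi> u"] that by force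
    then have "{\<phi> u<..} \<subseteq> \<phi> ` \<rat>" by auto
    then have "countable {\<phi> u<..}"
      using countable_rat countable_image countable_subset by blast
    then show False
      using uncountable_open_interval[of "\<phi> u" "\<phi> u + 1"] countable_subset[of "{\<phi> u<..<\<phi> u + 1}"]
      by force
  qed
  show ?thesis
  proof (rule that[of \<phi>])
    show "strict_mono_on I \<phi>" using strict by (intro strict_mono_onI)
    show "\<phi> ` I \<subseteq> {0..}" using phi_nonneg by auto
    show "{0<..} \<subseteq> \<phi> ` I" using surj by force
  qed (use hom in auto)
qed

text \<open>Both elements are identities, so a = a b = b.\<close>

lemma unique_if_idempotent:
  assumes "\<And>x. x \<in> I \<Longrightarrow> f x x = x" "a \<in> I" "b \<in> I"
  shows "a = b"
  using idempotent_neutral[of a b] idempotent_neutral[of b a] assms by metis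

section \<open>Consequences for semigroups of one sign\<close>

text \<open>The difference of the coordinates of \<open>x\<close> and \<open>w\<close> is positive,
  hence attained by some \<open>v\<close>. It solves both equations because addition commutes and
  the coordinate is injective.\<close>

lemma solvable_if_nonneg:
  assumes nonneg: "\<And>x. x \<in> I \<Longrightarrow> x \<le> f x x" and w: "w \<in> I" and x: "x \<in> I" and wx: "w < x"
  shows "\<exists>v\<in>I. f v w = x \<and> f w v = x"
proof -
  \<comment> \<open>Otherwise all elements would be idempotent and \<open>w\<close> would equal
    \<open>x\<close>.\<close>
  obtain p where p: "p \<in> I" "p < f p p"
    using unique_if_idempotent[OF _ w x] nonneg wx by (metis order_less_irrefl order_le_less)
  obtain \<phi> where \<phi>: "strict_mono_on I (\<phi> :: real \<Rightarrow> real)"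
    "\<And>x y. \<lbrakk>x \<in> I; y \<in> I\<rbrakk> \<Longrightarrow> \<phi> (f x y) = \<phi> x + \<phi> y" "{0<..} \<subseteq> \<phi> ` I"
    using additive_coordinate[OF nonneg p] by metis
  have "\<phi> x - \<phi> w \<in> \<phi> ` I"
    using \<phi>(3) strict_mono_onD[OF \<phi>(1) w x wx] by auto
  then obtain v where v: "v \<in> I" "\<phi> v = \<phi> x - \<phi> w" by auto
  have "inj_on \<phi> I" using \<phi>(1) by (rule strict_mono_on_imp_inj_on)
  moreover have "\<phi> (f v w) = \<phi> x" "\<phi> (f w v) = \<phi> x" using \<phi>(2) v w by auto
  ultimately show ?thesis using v(1) w x closed by (metis inj_onD)
qed

lemma continuous_on_if_nonneg:
  assumes nonneg: "\<And>x. x \<in> I \<Longrightarrow> x \<le> f x x"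
  shows "continuous_on (I \<times> I) (\<lambda>(x, y). f x y)"
proof (cases "\<exists>p\<in>I. p < f p p")
  case False
  \<comment> \<open>Without a positive element everything is idempotent, so \<open>I\<close> has at
    most one point.\<close>
  then have "\<And>x. x \<in> I \<Longrightarrow> f x x = x" using nonneg by (force simp: not_less intro: antisym)
  then have "\<exists>a. I \<times> I \<subseteq> {(a, a)}" using unique_if_idempotent by blast
  then show ?thesis using continuous_on_subset continuous_on_sing by blast
next
  case True
  then obtain \<phi> where \<phi>: "strict_mono_on I (\<phi> :: real \<Rightarrow> real)"
    "\<And>x y. \<lbrakk>x \<in> I; y \<in> I\<rbrakk> \<Longrightarrow> \<phi> (f x y) = \<phi> x + \<phi> y"
    "\<phi> ` I \<subseteq> {0..}" "{0<..} \<subseteq> \<phi> ` I"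
    using additive_coordinate[OF nonneg] by metis
  define \<psi> where "\<psi> = the_inv_into I \<phi>"
  have inj: "inj_on \<phi> I" using \<phi>(1) by (rule strict_mono_on_imp_inj_on)
  have \<psi>: "\<psi> (\<phi> x) = x" if "x \<in> I" for x
    unfolding \<psi>_def using the_inv_into_f_f[OF inj that] .
  have le_iff: "\<phi> x \<le> \<phi> y \<longleftrightarrow> x \<le> y" if "x \<in> I" "y \<in> I" for x y
    using strict_mono_on_less_eq[OF \<phi>(1) that] .
  have "is_interval (\<phi> ` I)"
    using \<phi>(3,4) unfolding is_interval_1
    by (smt (verit) atLeast_iff greaterThan_iff subset_iff)
  then have cont_\<phi>: "continuous_on I \<phi>"
    by (intro mono_on_interval_image_continuous_on mono_onI) (auto simp: le_iff)
  \<comment> \<open>The inverse is monotone with interval image \<open>I\<close>, so the same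
    criterion applies to it.\<close>
  have "\<psi> ` \<phi> ` I = I" using \<psi> by (force simp: image_iff)
  then have cont_\<psi>: "continuous_on (\<phi> ` I) \<psi>"
    using interval by (intro mono_on_interval_image_continuous_on mono_onI) (auto simp: le_iff \<psi>)
  have "continuous_on (I \<times> I) (\<lambda>z. \<psi> (\<phi> (fst z) + \<phi> (snd z)))"
  proof (rule continuous_on_compose2[OF cont_\<psi>])
    show "continuous_on (I \<times> I) (\<lambda>z. \<phi> (fst z) + \<phi> (snd z))"
      by (intro continuous_intros continuous_on_compose2[OF cont_\<phi>]) auto
    show "(\<lambda>z. \<phi> (fst z) + \<phi> (snd z)) ` (I \<times> I) \<subseteq> \<phi> ` I"
      using closed by (auto simp: \<phi>(2)[symmetric])
  qed
  then show ?thesis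
    by (rule continuous_on_eq) (auto simp: \<phi>(2)[symmetric] \<psi> closed)
qed

lemma continuous_on_if_nonpos:
  assumes nonpos: "\<And>x. x \<in> I \<Longrightarrow> f x x \<le> x"
  shows "continuous_on (I \<times> I) (\<lambda>(x, y). f x y)"
proof -
  interpret R: rooted_interval_semigroup "uminus ` I" "\<lambda>x y. - f (- x) (- y)"
    by (rule reflect)
  have cont: "continuous_on (uminus ` I \<times> uminus ` I) (\<lambda>(x, y). - f (- x) (- y))"
    using nonpos by (intro R.continuous_on_if_nonneg) auto
  have "continuous_on (I \<times> I) (\<lambda>z. case (- fst z, - snd z) of (x, y) \<Rightarrow> - f (- x) (- y))"
    by (rule continuous_on_compose2[OF cont]) (auto intro!: continuous_intros)
  then have "continuous_on (I \<times> I) (\<lambda>z. - (case (- fst z, - snd z) of (x, y) \<Rightarrow> - f (- x) (- y)))"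
    by (rule continuous_on_minus)
  then show ?thesis by (rule continuous_on_eq) auto
qed

end

section \<open>Semigroups with identity and the two-sided case\<close>

locale rooted_interval_monoid = rooted_interval_semigroup +
  fixes e
  assumes neutral_in: "e \<in> I" and neutral_idem: "f e e = e"
begin

lemma neutral: "x \<in> I \<Longrightarrow> f e x = x" "x \<in> I \<Longrightarrow> f x e = x"
  using idempotent_neutral[OF neutral_in neutral_idem] by auto

lemma less_square_iff: "x \<in> I \<Longrightarrow> x < f x x \<longleftrightarrow> e < x"
  using less_left_iff[of e x x] neutral neutral_in by simp

text \<open>Roots stay in this part: y < e would give y y < e e = e.\<close>

lemma nonneg_part: "rooted_interval_semigroup (I \<inter> {e..}) f"
proof (rule restrict)
  show "is_interval (I \<inter> {e..})" using interval by (intro is_interval_Int) auto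
  show "f a b \<in> I \<inter> {e..}" if "a \<in> I \<inter> {e..}" "b \<in> I \<inter> {e..}" for a b
    using that le_left[of e a b] closed neutral neutral_in by force
  show "y \<in> I \<inter> {e..}" if "y \<in> I" "f y y \<in> I \<inter> {e..}" for y
    using that square_less[of y e] neutral_in neutral_idem by force
qed auto

lemma nonneg_solvable:
  assumes "w \<in> I" "e \<le> w" "x \<in> I" "w < x"
  shows "\<exists>v\<in>I. f v w = x \<and> f w v = x"
proof -
  interpret P: rooted_interval_semigroup "I \<inter> {e..}" f by (rule nonneg_part)
  have "y \<le> f y y" if "y \<in> I \<inter> {e..}" for y
    using that less_square_iff[of y] neutral_idem by force
  then show ?thesis using P.solvable_if_nonneg[of w x] assms by auto
qed

lemma reflect_monoid: "rooted_interval_monoid (uminus ` I) (\<lambda>x y. - f (- x) (- y)) (- e)"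
  using reflect neutral_in neutral_idem
  by (auto simp: rooted_interval_monoid_def rooted_interval_monoid_axioms_def)

lemma nonpos_solvable:
  assumes "w \<in> I" "w \<le> e" "x \<in> I" "x < w"
  shows "\<exists>v\<in>I. f v w = x \<and> f w v = x"
proof -
  interpret R: rooted_interval_monoid "uminus ` I" "\<lambda>x y. - f (- x) (- y)" "- e"
    by (rule reflect_monoid)
  show ?thesis using R.nonneg_solvable[of "- w" "- x"] assms by auto
qed

text \<open>Compare p n with e. If equal, \<open>p\<close> and \<open>n\<close> are inverse. If p n
  > e, then p n < p, so (p n) v = p is solvable and cancelling \<open>p\<close> gives n v = e with v
  > e. If p n < e, then n < p n, and v (p n) = n gives v p = e.\<close>

lemma invertible_above_exists:
  assumes p: "p \<in> I" "e < p" and n: "n \<in> I" "n < e"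
  shows "\<exists>u\<in>I. \<exists>v\<in>I. e < u \<and> f u v = e \<and> f v u = e"
proof -
  \<comment> \<open>Cancel \<open>u\<close> from u (v u) = (u v) u = u e.\<close>
  have two_sided: "f v u = e" if "u \<in> I" "v \<in> I" "f u v = e" for u v
  proof -
    have "f u (f v u) = f u e" using that assoc[of u v u] neutral by simp
    then show ?thesis using eq_right_iff that closed neutral_in by blast
  qed
  have "\<exists>u\<in>I. \<exists>v\<in>I. e < u \<and> f u v = e"
  proof (cases "f p n" e rule: linorder_cases)
    case equal
    then show ?thesis using p n by blast
  next
    case greater
    have "f p n < p" using less_right[of n e p] p n neutral neutral_in by simp
    then obtain v where v: "v \<in> I" "f v (f p n) = p" "f (f p n) v = p"
      using nonneg_solvable[of "f p n" p] greater p n closed by auto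
    have "f p (f n v) = f p e" using v(3) assoc[of p n v] p n v(1) neutral by simp
    then have nv: "f n v = e" using eq_right_iff[of "f n v" e p] p n v(1) closed neutral_in by simp
    have "e < v"
    proof (rule ccontr)
      assume "\<not> e < v"
      then have "f n v \<le> f n e" using le_right[of v e n] n v(1) neutral_in by simp
      then show False using nv n neutral by simp
    qed
    then show ?thesis using two_sided[OF n(1) v(1) nv] v(1) n(1) by blast
  next
    case less
    have "n < f p n" using less_left[of e p n] p n neutral neutral_in by simp
    then obtain v where v: "v \<in> I" "f v (f p n) = n" "f (f p n) v = n"
      using nonpos_solvable[of "f p n" n] less p n closed by auto
    have "f (f v p) n = f e n" using v(2) assoc[of v p n] p n v(1) neutral by simp
    then have "f v p = e" using eq_left_iff[of "f v p" e n] p n v(1) closed neutral_in by simp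
    then show ?thesis using two_sided[OF v(1) p(1)] v(1) p by blast
  qed
  then show ?thesis using two_sided by blast
qed

text \<open>Iterated squares of \<open>u\<close> and \<open>v\<close> remain mutually inverse. Those
  of \<open>v\<close>, which is below \<open>e\<close>, eventually drop below \<open>c\<close>; then
  e = U V < U c, and likewise on the other side.\<close>

lemma invertible_unbounded:
  assumes u: "u \<in> I" "e < u" and v: "v \<in> I" "f u v = e" "f v u = e" and c: "c \<in> I"
  shows "\<exists>u\<in>I. \<exists>v\<in>I. f u v = e \<and> f v u = e \<and> e < f u c \<and> e < f c u"
proof -
  interpret R: rooted_interval_monoid "uminus ` I" "\<lambda>x y. - f (- x) (- y)" "- e"
    by (rule reflect_monoid)
  have "v < e"
  proof (rule ccontr)
    assume "\<not> v < e"
    then have "f u e \<le> f u v" using le_right[of e v u] u(1) v(1) neutral_in by simp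
    then show False using u v(2) neutral by simp
  qed
  then have "- v < - f (- (- v)) (- (- v))" using R.less_square_iff[of "- v"] v(1) by simp
  then obtain n where n: "- c < ((\<lambda>x. - f (- x) (- x)) ^^ n) (- v)"
    using R.square_iterate_unbounded[of "- v" "- c"] v(1) c by auto
  define U where "U k = ((\<lambda>x. f x x) ^^ k) u" for k
  define V where "V k = ((\<lambda>x. f x x) ^^ k) v" for k
  have UV: "U k \<in> I" "V k \<in> I" for k
    unfolding U_def V_def using square_iterate_in u(1) v(1) by auto
  have inv: "f (U k) (V k) = e \<and> f (V k) (U k) = e" for k
  proof (induction k)
    case 0 then show ?case using v by (simp add: U_def V_def)
  next
    case (Suc k)
    have cancel: "f (f x x) (f y y) = e" if "x \<in> I" "y \<in> I" "f x y = e" for x y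
    proof -
      have "f (f x x) (f y y) = f x (f (f x y) y)" using that(1,2) assoc closed by simp
      then show ?thesis using that neutral by simp
    qed
    show ?case using cancel Suc UV unfolding U_def V_def by simp
  qed
  have "((\<lambda>x. - f (- x) (- x)) ^^ n) (- v) = - V n" unfolding V_def by (induction n) auto
  then have "V n < c" using n by simp
  then have "f (U n) (V n) < f (U n) c" "f (V n) (U n) < f c (U n)"
    using less_left less_right UV c by auto
  then show ?thesis using inv UV by (metis (no_types))
qed

text \<open>An invertible translation is monotone and maps \<open>I\<close> onto
  \<open>I\<close>.\<close>

lemma continuous_on_translate:
  assumes u: "u \<in> I" and v: "v \<in> I" "f u v = e" "f v u = e"
  shows "continuous_on I (\<lambda>x. f u x)" "continuous_on I (\<lambda>x. f x u)"
proof -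
  have left: "f u (f v x) = x" if "x \<in> I" for x
    using assoc[of u v x] that u v neutral by simp
  have right: "f (f x v) u = x" if "x \<in> I" for x
    using assoc[of x v u] that u v neutral by simp
  have "(\<lambda>x. f u x) ` I = I"
    using left closed u v(1)
    by (metis (no_types, lifting) image_subset_iff image_eqI subsetI subset_antisym)
  then show "continuous_on I (\<lambda>x. f u x)"
    using interval u le_right by (intro mono_on_interval_image_continuous_on mono_onI) auto
  have "(\<lambda>x. f x u) ` I = I"
    using right closed u v(1)
    by (metis (no_types, lifting) image_subset_iff image_eqI subsetI subset_antisym)
  then show "continuous_on I (\<lambda>x. f x u)"
    using interval u le_left by (intro mono_on_interval_image_continuous_on mono_onI) auto
qed

lemma continuous_on_mult_if_two_sided:
  assumes p: "p \<in> I" "e < p" and n: "n \<in> I" "n < e"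
  shows "continuous_on (I \<times> I) (\<lambda>(x, y). f x y)"
proof -
  interpret P: rooted_interval_semigroup "I \<inter> {e..}" f by (rule nonneg_part)
  have cont_P: "continuous_on ((I \<inter> {e..}) \<times> (I \<inter> {e..})) (\<lambda>(x, y). f x y)"
    using less_square_iff neutral_idem by (intro P.continuous_on_if_nonneg) force
  have "continuous (at (a, b) within I \<times> I) (\<lambda>(x, y). f x y)" if a: "a \<in> I" and b: "b \<in> I" for a b
  proof -
    \<comment> \<open>Taking \<open>min a b\<close> makes one \<open>u\<close> serve both
      coordinates.\<close>
    obtain u v where u: "u \<in> I" and v: "v \<in> I" "f u v = e" "f v u = e"
      and big: "e < f u (min a b)" "e < f (min a b) u"
      using invertible_above_exists[OF p n] invertible_unbounded[of _ _ "min a b"] a b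
      by (metis min_def)
    \<comment> \<open>A relatively open neighbourhood of \<open>(a, b)\<close> on which both
      translated factors lie above \<open>e\<close>, where continuity is already known.\<close>
    define S where "S = {z \<in> I \<times> I. e < f u (fst z) \<and> e < f (snd z) u}"
    have cont_u: "continuous_on (I \<times> I) (\<lambda>z. f u (fst z))" "continuous_on (I \<times> I) (\<lambda>z. f (snd z) u)"
      using continuous_on_translate[OF u v]
      by (auto intro!: continuous_on_compose2[where f = fst] continuous_on_compose2[where f = snd]
          continuous_intros)
    have "openin (top_of_set (I \<times> I))
        ({z \<in> I \<times> I. f u (fst z) \<in> {e<..}} \<inter> {z \<in> I \<times> I. f (snd z) u \<in> {e<..}})"
      using cont_u by (intro openin_Int continuous_openin_preimage_gen[unfolded vimage_def Int_def, simplified]) auto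
    then have open_S: "openin (top_of_set (I \<times> I)) S"
      by (rule back_subst[where P = "openin _"]) (auto simp: S_def)
    have ab: "(a, b) \<in> S"
      using big le_right[of "min a b" a u] le_left[of "min a b" b u] a b u
      by (auto simp: S_def min_def split: if_splits)
    have SI: "S \<subseteq> I \<times> I" by (auto simp: S_def)
    have "continuous_on S (\<lambda>z. case (f u (fst z), f (snd z) u) of (x, y) \<Rightarrow> f x y)"
      using SI closed u cont_u[THEN continuous_on_subset, OF SI]
      by (intro continuous_on_compose2[OF cont_P] continuous_intros) (auto simp: S_def)
    then have "continuous_on S (\<lambda>z. f v (f (f u (fst z)) (f (snd z) u)))"
      using SI closed u by (intro continuous_on_compose2[OF continuous_on_translate(1)[OF v(1) u v(3,2)]]) auto
    then have "continuous_on S (\<lambda>z. f (f v (f (f u (fst z)) (f (snd z) u))) v)"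
      using SI closed u v by (intro continuous_on_compose2[OF continuous_on_translate(2)[OF v(1) u v(3,2)]]) auto
    \<comment> \<open>Reassociated, the product is (v u)(x y)(u v), and both outer factors are
      \<open>e\<close>.\<close>
    moreover have "f (f v (f (f u x) (f y u))) v = f x y" if "x \<in> I" "y \<in> I" for x y
    proof -
      have "f (f v (f (f u x) (f y u))) v = f (f (f v u) (f x y)) (f u v)"
        using that u v(1) assoc closed by simp
      then show ?thesis using that v neutral closed by simp
    qed
    ultimately have "continuous_on S (\<lambda>(x, y). f x y)"
      using SI by (elim continuous_on_eq) auto
    then have "continuous (at (a, b) within S) (\<lambda>(x, y). f x y)"
      using ab by (simp add: continuous_on_eq_continuous_within)
    moreover have "at (a, b) within S = at (a, b) within I \<times> I"
    proof -
      obtain T where T: "open T" "S = I \<times> I \<inter> T" using open_S by (auto simp: openin_open)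
      then show ?thesis using ab by (intro at_within_nhd[of _ T]) auto
    qed
    ultimately show ?thesis by (simp add: continuous_within)
  qed
  then show ?thesis by (auto simp: continuous_on_eq_continuous_within)
qed

end

section \<open>Reduction to the three sign cases\<close>

theorem theorem1p2:
  fixes I :: "real set" and f :: "real \<Rightarrow> real \<Rightarrow> real"
  assumes "is_interval I" and "I \<noteq> {}"
    and "strictly_linearly_ordered_semigroup I (usual_order_on I) f"
    and "\<And>x. x \<in> I \<Longrightarrow> admits_square_root I f x"
  shows "continuous_on (I \<times> I) (\<lambda>(x, y). f x y)"
proof -
  interpret S: strictly_linearly_ordered_semigroup I "usual_order_on I" f by fact
  interpret rooted_interval_semigroup I f
  proof
    show "f a x < f b x" "f x a < f x b" if "a \<in> I" "b \<in> I" "x \<in> I" "a < b" for a b x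
      using that S.strict_mono_left[of a b x] S.strict_mono_right[of a b x]
      by (auto simp: usual_order_on_def)
    show "\<exists>y\<in>I. f y y = x" if "x \<in> I" for x
      using assms(4)[OF that] by (simp add: admits_square_root_def)
  qed (use assms(1) S.closed S.assoc in auto)
  consider "\<And>x. x \<in> I \<Longrightarrow> x \<le> f x x" | "\<And>x. x \<in> I \<Longrightarrow> f x x \<le> x"
    | p n where "p \<in> I" "p < f p p" "n \<in> I" "f n n < n"
    by (meson not_le)
  then show ?thesis
  proof cases
    case 1 then show ?thesis by (rule continuous_on_if_nonneg)
  next
    case 2 then show ?thesis by (rule continuous_on_if_nonpos)
  next
    case (3 p n)
    \<comment> \<open>The zeros of \<open>g\<close> are the idempotents. Continuity of squaring and
      the opposite signs at \<open>n\<close> and \<open>p\<close> yield one by the intermediate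
      value property.\<close>
    define g where "g x = f x x - x" for x
    have "continuous_on I g"
      unfolding g_def by (intro continuous_intros continuous_on_square)
    then have "is_interval (g ` I)"
      using interval by (simp add: is_interval_connected_1 connected_continuous_image)
    moreover have "g p \<in> g ` I" "g n \<in> g ` I" "g n \<le> 0" "0 \<le> g p" using 3 by (auto simp: g_def)
    ultimately have "0 \<in> g ` I" unfolding is_interval_1 by blast
    then obtain e where "e \<in> I" "f e e = e" by (auto simp: g_def)
    then interpret rooted_interval_monoid I f e by unfold_locales
    have "e < p" using less_square_iff 3 by simp
    moreover have "n < e" using less_square_iff[of n] 3 neutral_idem by (cases n e rule: linorder_cases) auto
    ultimately show ?thesis using continuous_on_mult_if_two_sided 3 by blast
  qed
qed

end
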